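(* Let $N=2^J$ with some $J>0$, and let $\mathbf{x}\in\mathbb{C}^N$ have support length $m<N$, where the support length $m$ (or an upper bound $m<N$ of it) is known a priori. Then there is a deterministic algorithm that reconstructs $\mathbf{x}$ from its discrete Fourier transform $\widehat{\mathbf{x}}\in\mathbb{C}^N$ and that, in case of exact Fourier data, uses less than $4m$ Fourier samples (components of $\widehat{\mathbf{x}}$) and $\mathcal{O}(m\log_2 m)$ arithmetical operations to recover $\mathbf{x}$.
   Context: Vectors $\mathbf{x}=(x_k)_{k=0}^{N-1}\in\mathbb{C}^N$ are indexed from $0$ to $N-1$. Discrete Fourier transform: $\widehat{\mathbf{x}}=(\widehat{x}_k)_{k=0}^{N-1}=\mathbf{F}_N\mathbf{x}$ with $\mathbf{F}_N=(\omega_N^{jk})_{j,k=0}^{N-1}$ and $\omega_N=e^{-2\pi i/N}$. Support length: the support length of $\mathbf{x}\in\mathbb{C}^N$ is the minimal integer $m$ for which there exists $\mu\in\{0,\dots,N-1\}$ such that $x_k=0$ for all $k\notin\{(\mu+r)\bmod N:\ r=0,\dots,m-1\}$ (a cyclic interval; zero components inside the interval are allowed). Exact Fourier data means that the components of $\widehat{\mathbf{x}}$ are given without noise. *)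

theory Defs
  imports
    Complex_Main
    "HOL-Library.Landau_Symbols"
    "Jordan_Normal_Form.Matrix"
begin

section \<open>Discrete Fourier transform and support length\<close>

definition omega :: "nat \<Rightarrow> complex" where
  "omega N = exp (- 2 * of_real pi * \<i> / of_nat N)"

definition fourier_matrix :: "nat \<Rightarrow> complex mat" where
  "fourier_matrix N = mat N N (\<lambda>(j, k). omega N ^ (j * k))"

definition dft :: "complex vec \<Rightarrow> complex vec" where
  "dft x = fourier_matrix (dim_vec x) *\<^sub>v x"

definition support_length :: "complex vec \<Rightarrow> nat" where
  "support_length x = (LEAST m. \<exists>\<mu><dim_vec x. \<forall>k<dim_vec x.
     k \<notin> {(\<mu> + r) mod dim_vec x | r. r < m} \<longrightarrow> x $ k = 0)"

section \<open>Algorithms with access to Fourier samples\<close>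

text \<open>
  Algorithms are the programs of a while-language over a random access memory with integer
  variables (for index computations) and arrays of exact complex numbers.  Programs are
  finite pieces of syntax whose only numerical constants are integers and the imaginary unit;
  the length \<open>N\<close>, the bound \<open>m\<close> and the values of Fourier samples enter only at run time.

  Besides field operations and equality tests, the complex unit-cost operations are
  exp (for roots of unity), Arg (to read off the phase of a root of unity) and the floor of
  the real part (to turn the result into an index).  Some phase extraction of this kind is
  unavoidable in a bound that does not depend on \<open>N\<close>: with binary branching alone, already
  locating the nonzero entry of a vector of support length 1 takes order of
  \<open>log N\<close> comparisons.  Division by zero yields zero, as in HOL.
\<close>

type_synonym vname = string

datatype iexp =
    IConst int
  | IVar vname
  | IAdd iexp iexp
  | ISub iexp iexp
  | IMul iexp iexp
  | IDiv iexp iexp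
  | IMod iexp iexp
  | IFloor cexp
and cexp =
    CI
  | COfInt iexp
  | CGet vname iexp
  | CAdd cexp cexp
  | CSub cexp cexp
  | CMul cexp cexp
  | CDiv cexp cexp
  | CExp cexp
  | CArg cexp

datatype bexp =
    BLess iexp iexp
  | BEq cexp cexp
  | BNot bexp
  | BAnd bexp bexp

datatype com =
    SKIP
  | IAssign vname iexp
  | CAssign vname iexp cexp
  | Sample vname iexp iexp
  | Seq com com
  | Cond bexp com com
  | While bexp com

record state =
  ints :: "vname \<Rightarrow> int"
  arrs :: "vname \<Rightarrow> int \<Rightarrow> complex"

primrec ival :: "iexp \<Rightarrow> state \<Rightarrow> int" and cval :: "cexp \<Rightarrow> state \<Rightarrow> complex" where
  "ival (IConst c) s = c"
| "ival (IVar v) s = ints s v"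
| "ival (IAdd a b) s = ival a s + ival b s"
| "ival (ISub a b) s = ival a s - ival b s"
| "ival (IMul a b) s = ival a s * ival b s"
| "ival (IDiv a b) s = ival a s div ival b s"
| "ival (IMod a b) s = ival a s mod ival b s"
| "ival (IFloor z) s = \<lfloor>Re (cval z s)\<rfloor>"
| "cval CI s = \<i>"
| "cval (COfInt a) s = of_int (ival a s)"
| "cval (CGet v a) s = arrs s v (ival a s)"
| "cval (CAdd z w) s = cval z s + cval w s"
| "cval (CSub z w) s = cval z s - cval w s"
| "cval (CMul z w) s = cval z s * cval w s"
| "cval (CDiv z w) s = cval z s / cval w s"
| "cval (CExp z) s = exp (cval z s)"
| "cval (CArg z) s = of_real (Arg (cval z s))"

primrec bval :: "bexp \<Rightarrow> state \<Rightarrow> bool" where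
  "bval (BLess a b) s = (ival a s < ival b s)"
| "bval (BEq z w) s = (cval z s = cval w s)"
| "bval (BNot b) s = (\<not> bval b s)"
| "bval (BAnd b c) s = (bval b s \<and> bval c s)"

text \<open>Integer (index) operations are charged as well as complex ones.\<close>

primrec icost :: "iexp \<Rightarrow> nat" and ccost :: "cexp \<Rightarrow> nat" where
  "icost (IConst c) = 0"
| "icost (IVar v) = 0"
| "icost (IAdd a b) = icost a + icost b + 1"
| "icost (ISub a b) = icost a + icost b + 1"
| "icost (IMul a b) = icost a + icost b + 1"
| "icost (IDiv a b) = icost a + icost b + 1"
| "icost (IMod a b) = icost a + icost b + 1"
| "icost (IFloor z) = ccost z + 1"
| "ccost CI = 0"
| "ccost (COfInt a) = icost a + 1"
| "ccost (CGet v a) = icost a + 1"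
| "ccost (CAdd z w) = ccost z + ccost w + 1"
| "ccost (CSub z w) = ccost z + ccost w + 1"
| "ccost (CMul z w) = ccost z + ccost w + 1"
| "ccost (CDiv z w) = ccost z + ccost w + 1"
| "ccost (CExp z) = ccost z + 1"
| "ccost (CArg z) = ccost z + 1"

primrec bcost :: "bexp \<Rightarrow> nat" where
  "bcost (BLess a b) = icost a + icost b + 1"
| "bcost (BEq z w) = ccost z + ccost w + 1"
| "bcost (BNot b) = bcost b + 1"
| "bcost (BAnd b c) = bcost b + bcost c + 1"

definition set_int :: "vname \<Rightarrow> int \<Rightarrow> state \<Rightarrow> state" where
  "set_int v i s = s\<lparr>ints := (ints s)(v := i)\<rparr>"

definition set_arr :: "vname \<Rightarrow> int \<Rightarrow> complex \<Rightarrow> state \<Rightarrow> state" where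
  "set_arr v i z s = s\<lparr>arrs := (arrs s)(v := (arrs s v)(i := z))\<rparr>"

text \<open>
  \<open>exec y P s q t s'\<close>: with \<open>y\<close> as the vector of available Fourier data, \<open>P\<close> started in \<open>s\<close>
  terminates in \<open>s'\<close>, having read \<open>q\<close> components of \<open>y\<close> (repeated reads count
  repeatedly) and performed \<open>t\<close> elementary operations.  Only \<open>Sample\<close> accesses \<open>y\<close>.
\<close>

inductive exec :: "complex vec \<Rightarrow> com \<Rightarrow> state \<Rightarrow> nat \<Rightarrow> nat \<Rightarrow> state \<Rightarrow> bool" for y where
  Skip: "exec y SKIP s 0 0 s"
| IAssign: "exec y (IAssign v a) s 0 (icost a + 1) (set_int v (ival a s) s)"
| CAssign: "exec y (CAssign v a z) s 0 (icost a + ccost z + 1)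
    (set_arr v (ival a s) (cval z s) s)"
| Sample: "0 \<le> ival b s \<Longrightarrow> ival b s < int (dim_vec y) \<Longrightarrow>
    exec y (Sample v a b) s 1 (icost a + icost b + 1)
      (set_arr v (ival a s) (y $ nat (ival b s)) s)"
| Seq: "exec y P s q1 t1 s1 \<Longrightarrow> exec y Q s1 q2 t2 s2 \<Longrightarrow>
    exec y (Seq P Q) s (q1 + q2) (t1 + t2) s2"
| CondTrue: "bval b s \<Longrightarrow> exec y P s q t s1 \<Longrightarrow>
    exec y (Cond b P Q) s q (bcost b + 1 + t) s1"
| CondFalse: "\<not> bval b s \<Longrightarrow> exec y Q s q t s1 \<Longrightarrow>
    exec y (Cond b P Q) s q (bcost b + 1 + t) s1"
| WhileFalse: "\<not> bval b s \<Longrightarrow> exec y (While b P) s 0 (bcost b + 1) s"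
| WhileTrue: "bval b s \<Longrightarrow> exec y P s q1 t1 s1 \<Longrightarrow> exec y (While b P) s1 q2 t2 s2 \<Longrightarrow>
    exec y (While b P) s (q1 + q2) (bcost b + 1 + t1 + t2) s2"

lemma exec_deterministic:
  "exec y P s q t s' \<Longrightarrow> exec y P s q' t' s'' \<Longrightarrow> q = q' \<and> t = t' \<and> s' = s''"
proof (induction arbitrary: q' t' s'' rule: exec.induct)
  case (Skip s)
  then show ?case by cases simp_all
next
  case (IAssign v a s)
  then show ?case by cases simp_all
next
  case (CAssign v a z s)
  then show ?case by cases simp_all
next
  case (Sample b s v a)
  from Sample.prems show ?case by cases simp_all
next
  case (Seq P s q1 t1 s1 Q q2 t2 s2)
  note prems = Seq.prems and IH = Seq.IH
  from prems show ?case
  proof cases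
    case (Seq q1' t1' s1' q2' t2')
    with IH(1)[OF Seq(3)] have "exec y Q s1 q2' t2' s''" by simp
    from IH(2)[OF this] IH(1)[OF Seq(3)] Seq(1,2) show ?thesis by simp
  qed
next
  case (CondTrue b s P q t s1 Q)
  note prems = CondTrue.prems and hyps = CondTrue.hyps and IH = CondTrue.IH
  from prems show ?case
  proof cases
    case (CondTrue t1')
    from IH[OF CondTrue(3)] CondTrue(1) show ?thesis by simp
  next
    case CondFalse
    then show ?thesis using hyps by simp
  qed
next
  case (CondFalse b s Q q t s1 P)
  note prems = CondFalse.prems and hyps = CondFalse.hyps and IH = CondFalse.IH
  from prems show ?case
  proof cases
    case CondTrue
    then show ?thesis using hyps by simp
  next
    case (CondFalse t1')
    from IH[OF CondFalse(3)] CondFalse(1) show ?thesis by simp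
  qed
next
  case (WhileFalse b s P)
  from WhileFalse.prems show ?case
    by cases (use WhileFalse.hyps in simp_all)
next
  case (WhileTrue b s P q1 t1 s1 q2 t2 s2)
  note prems = WhileTrue.prems and hyps = WhileTrue.hyps and IH = WhileTrue.IH
  from prems show ?case
  proof cases
    case WhileFalse
    then show ?thesis using hyps by simp
  next
    case (WhileTrue q1' t1' s1' q2' t2')
    with IH(1)[OF WhileTrue(4)] have "exec y (While b P) s1 q2' t2' s''" by simp
    from IH(2)[OF this] IH(1)[OF WhileTrue(4)] WhileTrue(1,2) show ?thesis by simp
  qed
qed

text \<open>
  The memory is initialised with zeros.  The result is read off the array \<open>x\<close>, so components
  outside the support need not be written; writing all of them would cost \<open>N\<close> operations.
\<close>

definition initial_state :: "nat \<Rightarrow> nat \<Rightarrow> state" where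
  "initial_state N m =
     \<lparr>ints = (\<lambda>_. 0)(''N'' := int N, ''m'' := int m), arrs = (\<lambda>_ _. 0)\<rparr>"

definition output_vec :: "nat \<Rightarrow> state \<Rightarrow> complex vec" where
  "output_vec N s = vec N (\<lambda>k. arrs s ''x'' (int k))"

end

theory Submission
  imports Defs
begin

text \<open>
  Let \<open>M\<close> be the least power of two with \<open>m \<le> M\<close>, so \<open>M < 2 m\<close> and \<open>M\<close> divides \<open>N\<close>.  A cyclic
  interval of length at most \<open>M\<close> meets each residue class mod \<open>M\<close> at most once.  Hence, with
  \<open>\<omega> = omega N\<close>, the \<open>M\<close>-periodisations of \<open>x\<close> and of the vector with entries \<open>\<omega> ^ l * x $ l\<close>,
  obtained by inverse FFTs of length \<open>M\<close> from the samples at \<open>k N / M\<close> and \<open>k N / M + 1\<close>, hold at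
  position \<open>l mod M\<close> just \<open>x $ l\<close> and \<open>\<omega> ^ l * x $ l\<close> when \<open>x $ l\<close> is nonzero: the first gives
  the value, and the phase of the quotient gives the index \<open>l\<close>.
\<close>

section \<open>Resource-bounded total correctness\<close>

text \<open>By \<open>exec_deterministic\<close> the terminating run is the only one, so this is
  total correctness with upper bounds on reads and time. The state comes last so that
  \<open>runs y P q t Q\<close> is itself a state predicate and can be the postcondition of an
  earlier command, as in \<open>runs_Seq\<close>.\<close>

definition runs ::
  "complex vec \<Rightarrow> com \<Rightarrow> nat \<Rightarrow> nat \<Rightarrow> (state \<Rightarrow> bool) \<Rightarrow> state \<Rightarrow> bool" where
  "runs y P q t Q s \<longleftrightarrow> (\<exists>q' t' s'. exec y P s q' t' s' \<and> q' \<le> q \<and> t' \<le> t \<and> Q s')"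

lemma runs_weaken:
  assumes "runs y P q t Q s" "q \<le> q'" "t \<le> t'" "\<And>s. Q s \<Longrightarrow> Q' s"
  shows "runs y P q' t' Q' s"
  using assms unfolding runs_def by (meson le_trans)

lemma runs_SKIP: "Q s \<Longrightarrow> runs y SKIP q t Q s"
  unfolding runs_def using exec.Skip by blast

lemma runs_IAssign:
  "Q (set_int v (ival a s) s) \<Longrightarrow> runs y (IAssign v a) 0 (icost a + 1) Q s"
  unfolding runs_def using exec.IAssign by blast

lemma runs_CAssign:
  "Q (set_arr v (ival a s) (cval z s) s) \<Longrightarrow>
    runs y (CAssign v a z) 0 (icost a + ccost z + 1) Q s"
  unfolding runs_def using exec.CAssign by blast

lemma runs_Sample:
  assumes "0 \<le> ival b s" "ival b s < int (dim_vec y)"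
    and "Q (set_arr v (ival a s) (y $ nat (ival b s)) s)"
  shows "runs y (Sample v a b) 1 (icost a + icost b + 1) Q s"
  unfolding runs_def using exec.Sample[OF assms(1,2)] assms(3) by blast

lemma runs_Seq:
  assumes "runs y P q1 t1 (runs y P' q2 t2 Q) s"
  shows "runs y (Seq P P') (q1 + q2) (t1 + t2) Q s"
proof -
  obtain q t s1 where 1: "exec y P s q t s1" "q \<le> q1" "t \<le> t1" "runs y P' q2 t2 Q s1"
    using assms unfolding runs_def by blast
  then obtain q' t' s2 where 2: "exec y P' s1 q' t' s2" "q' \<le> q2" "t' \<le> t2" "Q s2"
    unfolding runs_def by blast
  show ?thesis
    unfolding runs_def using exec.Seq[OF 1(1) 2(1)] 1 2 by (meson add_mono)
qed

lemma runs_Seq_trans: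
  assumes "runs y P q1 t1 R s" and "\<And>s. R s \<Longrightarrow> runs y P' q2 t2 Q s"
  shows "runs y (Seq P P') (q1 + q2) (t1 + t2) Q s"
  by (rule runs_Seq, rule runs_weaken[OF assms(1) order_refl order_refl]) (rule assms(2))

lemma runs_Cond:
  assumes "bval b s \<Longrightarrow> runs y P q t Q s" and "\<not> bval b s \<Longrightarrow> runs y P' q t Q s"
  shows "runs y (Cond b P P') q (bcost b + 1 + t) Q s"
proof (cases "bval b s")
  case True
  from assms(1)[OF this] obtain q' t' s' where
    "exec y P s q' t' s'" "q' \<le> q" "t' \<le> t" "Q s'"
    unfolding runs_def by blast
  with exec.CondTrue[OF True] show ?thesis
    unfolding runs_def by (meson add_mono le_refl)
next
  case False
  from assms(2)[OF this] obtain q' t' s' where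
    "exec y P' s q' t' s'" "q' \<le> q" "t' \<le> t" "Q s'"
    unfolding runs_def by blast
  with exec.CondFalse[OF False] show ?thesis
    unfolding runs_def by (meson add_mono le_refl)
qed

text \<open>\<open>I\<close> is indexed by the number of completed rounds and the guard fails after
  exactly \<open>n\<close> of them; hence \<open>n\<close> bodies but \<open>n + 1\<close> guard
  evaluations.\<close>

lemma runs_While:
  assumes "I 0 s"
    and guard: "\<And>k s. k \<le> n \<Longrightarrow> I k s \<Longrightarrow> bval b s \<longleftrightarrow> k < n"
    and body: "\<And>k s. k < n \<Longrightarrow> I k s \<Longrightarrow> runs y P q t (I (Suc k)) s"
  shows "runs y (While b P) (n * q) (n * (bcost b + 1 + t) + (bcost b + 1)) (I n) s"
proof -
  \<comment> \<open>Induction on the number \<open>j\<close> of rounds still to go; the round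
    counter is then \<open>n - j\<close>.\<close>
  have "runs y (While b P) (j * q) (j * (bcost b + 1 + t) + (bcost b + 1)) (I n) s"
    if "j \<le> n" "I (n - j) s" for j s
    using that
  proof (induction j arbitrary: s)
    case 0
    then have "\<not> bval b s" using guard[of n s] by simp
    from exec.WhileFalse[OF this] 0 show ?case unfolding runs_def by fastforce
  next
    case (Suc j)
    have lt: "n - Suc j < n" and S: "Suc (n - Suc j) = n - j" using Suc.prems by auto
    have b: "bval b s" using guard[OF _ Suc.prems(2)] lt by simp
    obtain q1 t1 s1 where 1: "exec y P s q1 t1 s1" "q1 \<le> q" "t1 \<le> t" "I (n - j) s1"
      using body[OF lt Suc.prems(2)] unfolding S runs_def by blast
    obtain q2 t2 s2 where 2: "exec y (While b P) s1 q2 t2 s2" "q2 \<le> j * q"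
      "t2 \<le> j * (bcost b + 1 + t) + (bcost b + 1)" "I n s2"
      using Suc.IH[OF _ 1(4)] Suc.prems(1) unfolding runs_def by auto
    have "q1 + q2 \<le> Suc j * q"
      "bcost b + 1 + t1 + t2 \<le> Suc j * (bcost b + 1 + t) + (bcost b + 1)"
      using 1 2 by auto
    with exec.WhileTrue[OF b 1(1) 2(1)] 2(4) show ?case unfolding runs_def by blast
  qed
  from this[of n s] assms(1) show ?thesis by simp
qed

lemma ints_set [simp]:
  "ints (set_int v i s) w = (if w = v then i else ints s w)"
  "ints (set_arr v i z s) = ints s"
  "arrs (set_int v i s) = arrs s"
  "arrs (set_arr v i z s) w j = (if w = v \<and> j = i then z else arrs s w j)"
  by (auto simp: set_int_def set_arr_def)

section \<open>The radix-2 recurrence\<close>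

text \<open>Index \<open>e = r * n + i\<close> holds the \<open>i\<close>-th unnormalised inverse Fourier coefficient of the
  subsequence of \<open>a\<close> with offset \<open>r\<close> and stride \<open>M div n\<close>; this order avoids bit reversal.\<close>

definition fft_stage :: "nat \<Rightarrow> (nat \<Rightarrow> complex) \<Rightarrow> nat \<Rightarrow> nat \<Rightarrow> complex" where
  "fft_stage M a n e =
     (\<Sum>q<n. a (e div n + q * (M div n)) * cis (2 * pi * real (q * e) / real n))"

lemma cis_2pi_mod_eq:
  assumes "a mod n = b mod n" "n > 0"
  shows "cis (2 * pi * real a / real n) = cis (2 * pi * real b / real n)"
proof -
  have *: "cis (2 * pi * real c / real n) = cis (2 * pi * real (c mod n) / real n)" for c
  proof -
    have "real c = real n * real (c div n) + real (c mod n)"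
      by (metis mult_div_mod_eq of_nat_add of_nat_mult)
    then have "2 * pi * real c / real n
      = 2 * pi * real (c div n) + 2 * pi * real (c mod n) / real n"
      using assms(2) by (simp add: field_simps)
    then show ?thesis
      using cis_multiple_2pi[of "real (c div n)"] by (simp flip: cis_mult)
  qed
  from *[of a] *[of b] assms show ?thesis by simp
qed

lemma sum_even_odd:
  "(\<Sum>q<2 * n. f q) = (\<Sum>q<n. f (2 * q)) + (\<Sum>q<n. f (2 * q + 1 :: nat) :: 'a :: comm_monoid_add)"
  by (induction n) (simp_all add: algebra_simps)

text \<open>Split \<open>q\<close> by parity. With \<open>r = e div (2 * n)\<close>, even terms run
  through the subsequence of offset \<open>r\<close> and odd ones through that of offset
  \<open>r + p\<close>, both of stride \<open>2 * p\<close>; block \<open>r + p\<close> lies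
  \<open>p * n = M div 2\<close> entries further on. Both halves of the butterfly are covered, since
  the factor \<open>cis (pi * real e / real n)\<close> changes sign when \<open>e\<close> grows by
  \<open>n\<close>.\<close>

lemma fft_stage_double:
  assumes n: "n > 0" and M: "M = 2 * n * p"
  defines "k e \<equiv> e div (2 * n) * n + e mod n"
  shows "fft_stage M a (2 * n) e = fft_stage M a n (k e) +
    cis (pi * real e / real n) * fft_stage M a n (k e + M div 2)"
proof -
  have M2: "M div 2 = p * n" "M div (2 * n) = p" "M div n = 2 * p"
    using n by (simp_all add: M)
  have kd: "k e div n = e div (2 * n)" "(k e + M div 2) div n = e div (2 * n) + p"
    using n by (simp_all add: k_def M2)
  have km: "k e mod n = e mod n" "(k e + M div 2) mod n = e mod n"
    by (simp_all add: k_def M2)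
  \<comment> \<open>The phases at the two source indices depend only on residues mod
    \<open>n\<close>, so they may be written with \<open>e\<close>.\<close>
  have c: "cis (2 * pi * real (q * f) / real n) = cis (2 * pi * real (q * e) / real n)"
    if "f mod n = e mod n" for q f
    by (rule cis_2pi_mod_eq) (use that n in \<open>auto intro: mod_mult_cong\<close>)
  have even: "cis (2 * pi * real (2 * q * e) / real (2 * n)) = cis (2 * pi * real (q * e) / real n)"
    for q using n by (simp add: field_simps)
  have odd: "cis (2 * pi * real ((2 * q + 1) * e) / real (2 * n)) =
     cis (pi * real e / real n) * cis (2 * pi * real (q * e) / real n)" for q
  proof -
    have "2 * pi * real ((2 * q + 1) * e) / real (2 * n)
      = pi * real e / real n + 2 * pi * real (q * e) / real n"
      using n by (simp add: field_simps)
    then show ?thesis by (simp only: cis_mult)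
  qed
  show ?thesis
    unfolding fft_stage_def sum_even_odd even odd c[OF km(1)] c[OF km(2)] kd
    unfolding M2 by (simp add: sum_distrib_left algebra_simps)
qed

section \<open>Periodisation\<close>

lemma omega_power: "omega N ^ k = cis (- 2 * pi * real k / real N)"
proof -
  have "omega N = cis (- 2 * pi / real N)"
    by (simp add: omega_def cis_conv_exp mult_ac)
  then show ?thesis by (simp only: DeMoivre) (simp add: mult_ac)
qed

lemma omega_power_mod:
  assumes "N > 0" "a mod N = b mod N" shows "omega N ^ a = omega N ^ b"
proof -
  have "omega N ^ c = cnj (cis (2 * pi * real c / real N))" for c
    by (simp add: omega_power cis_cnj)
  with cis_2pi_mod_eq[OF assms(2,1)] show ?thesis by simp
qed

lemma dft_nth:
  assumes "x \<in> carrier_vec N" "i < N"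
  shows "dft x $ i = (\<Sum>l<N. omega N ^ (i * l) * x $ l)"
  using assms by (simp add: dft_def fourier_matrix_def scalar_prod_def lessThan_atLeast0)

text \<open>Orthogonality of roots of unity: a geometric sum whose ratio \<open>w\<close> satisfies
  \<open>w ^ M = 1\<close>. \<open>d\<close> is an integer because it will be a difference of two
  indices.\<close>

lemma sum_cis_period:
  fixes d :: int
  assumes "M > 0"
  shows "(\<Sum>k<M. cis (2 * pi * real k * of_int d / real M)) = (if int M dvd d then of_nat M else 0)"
proof -
  define w where "w = cis (2 * pi * of_int d / real M)"
  have pw: "cis (2 * pi * real k * of_int d / real M) = w ^ k" for k
    unfolding w_def by (simp only: DeMoivre) (simp add: field_simps)
  have wM: "w ^ M = 1"
  proof -
    have "2 * pi * real M * of_int d / real M = 2 * pi * of_int d" using assms by simp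
    then show ?thesis unfolding pw[symmetric] by (simp only:) (simp only: cis_multiple_2pi Ints_of_int)
  qed
  show ?thesis
  proof (cases "int M dvd d")
    case True
    then obtain c where "d = int M * c" by (auto simp: dvd_def)
    then have "w = 1" unfolding w_def using assms cis_multiple_2pi[of "of_int c"] by (simp add: mult.assoc)
    then show ?thesis using True by (simp add: pw)
  next
    case False
    have "w \<noteq> 1"
    proof
      assume "w = 1"
      then have "cos (2 * pi * of_int d / real M) = 1" unfolding w_def by (simp add: complex_eq_iff)
      then obtain c where "2 * pi * of_int d / real M = of_int c * 2 * pi"
        using cos_one_2pi_int by blast
      then have "(of_int d :: real) = of_int (c * int M)"
        using assms by (simp add: field_simps)
      then show False using False by (simp only: of_int_eq_iff) simp
    qed
    then show ?thesis using False wM by (simp add: pw geometric_sum)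
  qed
qed

text \<open>Reading the spectrum with stride \<open>p\<close> folds \<open>x\<close> with period
  \<open>M = N / p\<close>; the shift \<open>c\<close> of the read positions becomes the modulation
  \<open>omega N ^ (c * l)\<close>. Orthogonality keeps just the \<open>l\<close> in residue class
  \<open>j\<close>.\<close>

lemma fft_of_samples:
  assumes x: "x \<in> carrier_vec N" and N: "N = M * p" "N > 0" and j: "j < M"
  defines "y \<equiv> \<lambda>c k. dft x $ ((k * p + c) mod N)"
  shows "fft_stage M (y c) M j =
    of_nat M * (\<Sum>l | l < N \<and> l mod M = j. omega N ^ (c * l) * x $ l)"
proof -
  have M: "M > 0" using N by (cases M) auto
  have p: "p > 0" using N by (cases p) auto
  \<comment> \<open>Since \<open>omega N\<close> has period \<open>N\<close>, the wrap-around is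
    harmless, and the two phases merge into one in \<open>j - l\<close>.\<close>
  have tw: "omega N ^ ((k * p + c) mod N * l) * cis (2 * pi * real (k * j) / real M)
     = omega N ^ (c * l) * cis (2 * pi * real k * of_int (int j - int l) / real M)" for k l
  proof -
    have "omega N ^ ((k * p + c) mod N * l) = omega N ^ (k * p * l) * omega N ^ (c * l)"
      unfolding power_add[symmetric] using N by (intro omega_power_mod) (simp_all add: mod_mult_left_eq add_mult_distrib)
    also have "omega N ^ (k * p * l) = cis (- 2 * pi * real (k * l) / real M)"
      unfolding omega_power using N(1) M p by (simp add: field_simps)
    finally show ?thesis
      by (simp add: cis_mult) (simp add: right_diff_distrib diff_divide_distrib mult_ac)
  qed
  have dv: "int M dvd int j - int l \<longleftrightarrow> l mod M = j" for l
    using j by (metis mod_eq_dvd_iff mod_less of_nat_eq_iff zmod_int)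
  have "fft_stage M (y c) M j
    = (\<Sum>k<M. \<Sum>l<N. omega N ^ ((k * p + c) mod N * l) * cis (2 * pi * real (k * j) / real M) * x $ l)"
    unfolding fft_stage_def using j M
    by (intro sum.cong refl) (simp add: y_def dft_nth[OF x] N(2) sum_distrib_left mult_ac)
  also have "\<dots> = (\<Sum>l<N. omega N ^ (c * l) * x $ l *
      (\<Sum>k<M. cis (2 * pi * real k * of_int (int j - int l) / real M)))"
    unfolding tw by (subst sum.swap) (simp add: sum_distrib_left mult_ac)
  also have "\<dots> = (\<Sum>l<N. if l mod M = j then of_nat M * (omega N ^ (c * l) * x $ l) else 0)"
    unfolding sum_cis_period[OF M] dv by (intro sum.cong) auto
  also have "\<dots> = of_nat M * (\<Sum>l | l < N \<and> l mod M = j. omega N ^ (c * l) * x $ l)"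
    by (simp add: sum.If_cases sum_distrib_left Int_def lessThan_def)
  finally show ?thesis .
qed

text \<open>Both indices have the form \<open>(\<mu> + r) mod N\<close> with \<open>r < M\<close>.
  As \<open>M\<close> divides \<open>N\<close>, the reduction mod \<open>N\<close> is invisible mod
  \<open>M\<close>, and congruent offsets below \<open>M\<close> are equal.\<close>

lemma support_residue_unique:
  assumes "support_length x \<le> M" "N = dim_vec x" "M dvd N" "M > 0"
    and l: "l < N" "x $ l \<noteq> 0" and l': "l' < N" "x $ l' \<noteq> 0" and eq: "l mod M = l' mod M"
  shows "l = l'"
proof -
  let ?P = "\<lambda>m. \<exists>\<mu><dim_vec x. \<forall>k<dim_vec x.
     k \<notin> {(\<mu> + r) mod dim_vec x | r. r < m} \<longrightarrow> x $ k = 0"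
  \<comment> \<open>The interval of length \<open>N\<close> from 0 covers every index, so
    \<open>LEAST\<close> is attained; \<open>l < N\<close> makes 0 an admissible start.\<close>
  have "?P N"
    using l assms(2) by (intro exI[of _ 0]) force
  then have "?P (support_length x)" unfolding support_length_def by (rule LeastI)
  then obtain \<mu> where mu: "\<And>k. k < N \<Longrightarrow> x $ k \<noteq> 0 \<Longrightarrow>
      \<exists>r<support_length x. k = (\<mu> + r) mod N"
    using assms(2) by blast
  obtain r where r: "r < M" "l = (\<mu> + r) mod N" using mu[OF l] assms(1) by (metis less_le_trans)
  obtain r' where r': "r' < M" "l' = (\<mu> + r') mod N" using mu[OF l'] assms(1) by (metis less_le_trans)
  have "(\<mu> + r) mod M = (\<mu> + r') mod M"
    using eq r r' assms(3) by (simp add: mod_mod_cancel)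
  \<comment> \<open>\<open>\<mu>\<close> is cancelled over the integers, where subtraction is not
    truncated.\<close>
  then have "int r mod int M = int r' mod int M"
    by (metis mod_add_cong add_diff_cancel_left' mod_diff_left_eq of_nat_add zmod_int)
  then have "r = r'" using r r' by (metis mod_less of_nat_eq_iff zmod_int)
  then show ?thesis using r r' by simp
qed

lemma samples_locate:
  assumes x: "x \<in> carrier_vec N" and N: "N = M * p" "N > 0"
    and sl: "support_length x \<le> M" and l: "l < N" "x $ l \<noteq> 0"
  shows "fft_stage M (\<lambda>k. dft x $ ((k * p + c) mod N)) M (l mod M)
    = of_nat M * (omega N ^ (c * l) * x $ l)"
proof -
  have M: "M > 0" using N by (cases M) auto
  have "(\<Sum>i | i < N \<and> i mod M = l mod M. omega N ^ (c * i) * x $ i)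
    = (\<Sum>i\<in>{l}. omega N ^ (c * i) * x $ i)"
  proof (rule sum.mono_neutral_right)
    show "\<forall>i\<in>{i. i < N \<and> i mod M = l mod M} - {l}. omega N ^ (c * i) * x $ i = 0"
    proof
      fix i assume i: "i \<in> {i. i < N \<and> i mod M = l mod M} - {l}"
      with support_residue_unique[OF sl _ _ M _ _ l, of i] x N have "x $ i = 0" by auto
      then show "omega N ^ (c * i) * x $ i = 0" by simp
    qed
  qed (use l in auto)
  then show ?thesis using fft_of_samples[OF x N, of "l mod M" c] M by simp
qed

text \<open>Used contrapositively: a nonzero coefficient certifies a nonzero entry of
  \<open>x\<close> in its residue class.\<close>

lemma fft_of_samples_eq_0:
  assumes "x \<in> carrier_vec N" "N = M * p" "N > 0" "j < M"
    and "\<And>l. l < N \<Longrightarrow> l mod M = j \<Longrightarrow> x $ l = 0"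
  shows "fft_stage M (\<lambda>k. dft x $ ((k * p + c) mod N)) M j = 0"
  using fft_of_samples[OF assms(1-4), of c] assms(5) by simp

text \<open>The angle of \<open>omega N ^ l\<close> is \<open>- 2 * pi * l / N\<close> up to a
  multiple of \<open>2 * pi\<close>, so the rescaled \<open>Arg\<close> is exactly the integer
  \<open>l - c * N\<close>. The floor thus changes nothing, and \<open>mod N\<close> removes the
  dependence on the branch of \<open>Arg\<close>.\<close>

lemma index_of_phase:
  assumes "l < N"
  shows "\<lfloor>Re (of_real (Arg (omega N ^ l)) * of_nat N / (- 2 * of_real pi))\<rfloor> mod int N = int l"
proof -
  define z where "z = omega N ^ l"
  have "cis (Arg z) = cis (- 2 * pi * real l / real N)"
    using cis_Arg[of z] by (simp add: z_def omega_power sgn_eq)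
  then have "cis (Arg z + 2 * pi * real l / real N) = 1"
    unfolding cis_mult[symmetric] by (simp add: cis_mult)
  then have "cos (Arg z + 2 * pi * real l / real N) = 1" by (simp add: complex_eq_iff)
  then obtain c where "Arg z + 2 * pi * real l / real N = of_int c * 2 * pi"
    using cos_one_2pi_int by blast
  then have "Arg z * real N / (- 2 * pi) = of_int (int l - c * int N)"
    using assms by (simp add: field_simps)
  moreover have "of_real (Arg z) * of_nat N / (- 2 * of_real pi)
      = (of_real (Arg z * real N / (- 2 * pi)) :: complex)" by simp
  ultimately have "\<lfloor>Re (of_real (Arg z) * of_nat N / (- 2 * of_real pi))\<rfloor> = int l - c * int N"
    by (simp only: Re_complex_of_real floor_of_int)
  then show ?thesis using assms by (simp add: z_def mod_diff_eq[symmetric])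
qed

text \<open>The programs have no constant for \<open>pi\<close>; they compute it as
  \<open>Arg (- 1)\<close>.\<close>

lemma Arg_minus_1: "Arg (- 1) = pi"
  by (rule cis_Arg_unique) (simp_all add: sgn_eq cis_pi)

section \<open>The algorithm\<close>

definition grow_loop :: com where
  "grow_loop = While (BLess (IVar ''M'') (IVar ''m''))
     (IAssign ''M'' (IMul (IConst 2) (IVar ''M'')))"

text \<open>The target \<open>M + k\<close> is entry \<open>k\<close> of stage 1, stored at offset
  \<open>1 * M\<close>. For \<open>c = 1\<close> the outer reduction mod \<open>N\<close> takes
  effect only if \<open>M = N\<close> and \<open>k = M - 1\<close>.\<close>

definition take_sample :: "vname \<Rightarrow> int \<Rightarrow> com" where
  "take_sample v c = Sample v (IAdd (IVar ''M'') (IVar ''k''))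
     (IMod (IAdd (IMul (IVar ''k'') (IDiv (IVar ''N'') (IVar ''M''))) (IConst c)) (IVar ''N''))"

definition next_k :: com where
  "next_k = IAssign ''k'' (IAdd (IVar ''k'') (IConst 1))"

definition for_k :: "com \<Rightarrow> com" where
  "for_k P = Seq (IAssign ''k'' (IConst 0))
     (While (BLess (IVar ''k'') (IVar ''M'')) (Seq P next_k))"

definition sampling :: com where
  "sampling = for_k (Seq (take_sample ''a'' 0) (take_sample ''b'' 1))"

text \<open>The source index \<open>k e\<close> of \<open>fft_stage_double\<close> at
  \<open>e = k\<close>, shifted by the offset \<open>n * M\<close> of its stage.\<close>

definition lower_index :: iexp where
  "lower_index = IAdd (IMul (IVar ''n'') (IVar ''M''))
     (IAdd (IMul (IDiv (IVar ''k'') (IMul (IConst 2) (IVar ''n''))) (IVar ''n''))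
       (IMod (IVar ''k'') (IVar ''n'')))"

definition twiddle :: cexp where
  "twiddle = CExp (CMul CI (CMul (CArg (COfInt (IConst (- 1))))
     (CDiv (COfInt (IVar ''k'')) (COfInt (IVar ''n'')))))"

definition combine :: "vname \<Rightarrow> com" where
  "combine v = CAssign v (IAdd (IMul (IMul (IConst 2) (IVar ''n'')) (IVar ''M'')) (IVar ''k''))
     (CAdd (CGet v lower_index)
       (CMul twiddle (CGet v (IAdd lower_index (IDiv (IVar ''M'') (IConst 2))))))"

definition fft :: com where
  "fft = Seq (IAssign ''n'' (IConst 1))
     (While (BLess (IVar ''n'') (IVar ''M''))
       (Seq (for_k (Seq (combine ''a'') (combine ''b'')))
         (IAssign ''n'' (IMul (IConst 2) (IVar ''n'')))))"

definition top_entry :: "vname \<Rightarrow> cexp" where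
  "top_entry v = CGet v (IAdd (IMul (IVar ''M'') (IVar ''M'')) (IVar ''k''))"

text \<open>The expression of \<open>index_of_phase\<close>, with the quotient of the two transforms
  in place of \<open>omega N ^ l\<close>.\<close>

definition located_index :: iexp where
  "located_index = IMod (IFloor (CDiv
     (CMul (CArg (CDiv (top_entry ''b'') (top_entry ''a''))) (COfInt (IVar ''N'')))
     (CMul (COfInt (IConst (- 2))) (CArg (COfInt (IConst (- 1))))))) (IVar ''N'')"

definition recover :: com where
  "recover = for_k (Cond (BEq (top_entry ''a'') (COfInt (IConst 0))) SKIP
     (CAssign ''x'' located_index (CDiv (top_entry ''a'') (COfInt (IVar ''M'')))))"

definition reconstruct :: com where
  "reconstruct = Seq (IAssign ''M'' (IConst 1)) (Seq grow_loop (Seq sampling (Seq fft recover)))"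

section \<open>Correctness and cost of the pieces of the program\<close>

definition prep :: "nat \<Rightarrow> nat \<Rightarrow> state \<Rightarrow> bool" where
  "prep N M s \<longleftrightarrow> ints s ''N'' = int N \<and> ints s ''M'' = int M \<and> (\<forall>i. arrs s ''x'' i = 0)"

text \<open>The stage of block length \<open>n\<close> is stored at offset \<open>n * M\<close>, so no stage overwrites another.\<close>

definition level :: "vname \<Rightarrow> nat \<Rightarrow> nat \<Rightarrow> (nat \<Rightarrow> complex) \<Rightarrow> nat \<Rightarrow> state \<Rightarrow> bool" where
  "level v M n f j s \<longleftrightarrow> (\<forall>e<j. arrs s v (int (n * M + e)) = f e)"

text \<open>The increment is charged here once and for all, so the body only has to reach the next
  invariant up to that increment. Each round costs \<open>t\<close>, 2 for the increment and 2 for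
  the guard; initialisation and the last guard add 3.\<close>

lemma runs_for_k:
  assumes start: "I 0 (set_int ''k'' 0 s)"
    and inv: "\<And>k s. I k s \<Longrightarrow> ints s ''k'' = int k \<and> ints s ''M'' = int M"
    and body: "\<And>k s. k < M \<Longrightarrow> I k s \<Longrightarrow>
      runs y P q t (\<lambda>s. I (Suc k) (set_int ''k'' (ints s ''k'' + 1) s)) s"
  shows "runs y (for_k P) (M * q) (M * (t + 4) + 3) (I M) s"
proof -
  have "runs y (Seq P next_k) q (t + 2) (I (Suc k)) s" if "k < M" "I k s" for k s
  proof -
    have "runs y (Seq P next_k) (q + 0) (t + 2) (I (Suc k)) s"
    proof (rule runs_Seq, rule runs_weaken[OF body[OF that] order_refl order_refl])
      fix s assume "I (Suc k) (set_int ''k'' (ints s ''k'' + 1) s)"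
      then show "runs y next_k 0 2 (I (Suc k)) s"
        unfolding next_k_def
        by (intro runs_weaken[OF runs_IAssign order_refl]) auto
    qed
    then show ?thesis by simp
  qed
  then have "runs y (While (BLess (IVar ''k'') (IVar ''M'')) (Seq P next_k)) (M * q)
     (M * (bcost (BLess (IVar ''k'') (IVar ''M'')) + 1 + (t + 2)) + (bcost (BLess (IVar ''k'') (IVar ''M'')) + 1))
     (I M) (set_int ''k'' 0 s)"
    using start inv by (intro runs_While) auto
  then have "runs y (for_k P) (0 + M * q) (icost (IConst 0) + 1 +
     (M * (bcost (BLess (IVar ''k'') (IVar ''M'')) + 1 + (t + 2)) + (bcost (BLess (IVar ''k'') (IVar ''M'')) + 1)))
     (I M) s"
    unfolding for_k_def by (intro runs_Seq runs_IAssign) simp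
  then show ?thesis
    by (rule runs_weaken) (auto simp: algebra_simps)
qed

text \<open>The hypotheses make \<open>2 ^ L\<close> the least power of two not below
  \<open>m\<close>, so exactly \<open>L\<close> doublings take place.\<close>

lemma runs_grow_loop:
  assumes "m \<le> 2 ^ L" "\<And>i. i < L \<Longrightarrow> 2 ^ i < m"
    and "ints s ''M'' = 1" "ints s ''m'' = int m" "ints s ''N'' = int N" "arrs s ''x'' = (\<lambda>_. 0)"
  shows "runs y grow_loop 0 (4 * L + 2) (prep N (2 ^ L)) s"
proof -
  let ?I = "\<lambda>i s. prep N (2 ^ i) s \<and> ints s ''m'' = int m"
  have guard: "ints s ''M'' < ints s ''m'' \<longleftrightarrow> i < L" if "i \<le> L" "?I i s" for i s
  proof -
    have "2 ^ i < m \<longleftrightarrow> i < L" using assms(1) assms(2)[of i] that(1) by (cases "i = L") auto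
    moreover have "ints s ''M'' = int (2 ^ i)" "ints s ''m'' = int m"
      using that(2) by (simp_all add: prep_def)
    ultimately show ?thesis by (simp only: of_nat_less_iff)
  qed
  have "runs y grow_loop (L * 0) (L * (bcost (BLess (IVar ''M'') (IVar ''m'')) + 1 +
      (icost (IMul (IConst 2) (IVar ''M'')) + 1)) + (bcost (BLess (IVar ''M'') (IVar ''m'')) + 1)) (?I L) s"
    unfolding grow_loop_def
  proof (rule runs_While)
    show "?I 0 s" using assms by (simp add: prep_def)
  next
    fix i s assume "i \<le> L" "?I i s"
    then show "bval (BLess (IVar ''M'') (IVar ''m'')) s \<longleftrightarrow> i < L"
      using guard by simp
  next
    fix i s assume "i < L" "?I i s"
    then show "runs y (IAssign ''M'' (IMul (IConst 2) (IVar ''M''))) 0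
        (icost (IMul (IConst 2) (IVar ''M'')) + 1) (?I (Suc i)) s"
      by (intro runs_IAssign) (simp add: prep_def)
  qed
  then show ?thesis by (rule runs_weaken) auto
qed

lemma level_set_arr:
  assumes "level v M n f j s"
    and "w = v \<Longrightarrow> (\<exists>i. c = int (n * M + i) \<and> j \<le> i)"
  shows "level v M n f j (set_arr w c z s)"
  using assms by (fastforce simp: level_def)

lemma level_set_int [simp]: "level v M n f j (set_int w i s) = level v M n f j s"
  by (simp add: level_def)

lemma level_0 [simp]: "level v M n f 0 s"
  by (simp add: level_def)

text \<open>These two reads per round are the only ones in the whole program, which gives its sample
  count \<open>2 * M\<close>.\<close>

lemma runs_sampling:
  assumes s: "prep N M s" and N: "N = M * p" "N > 0" and y: "dim_vec y = N"
  shows "runs y sampling (2 * M) (16 * M + 3)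
    (\<lambda>s. prep N M s \<and> level ''a'' M 1 (\<lambda>k. y $ ((k * p + 0) mod N)) M s \<and>
      level ''b'' M 1 (\<lambda>k. y $ ((k * p + 1) mod N)) M s) s"
proof -
  let ?f = "\<lambda>c k. y $ ((k * p + c) mod N)"
  let ?I = "\<lambda>k s. prep N M s \<and> level ''a'' M 1 (?f 0) k s \<and> level ''b'' M 1 (?f 1) k s
    \<and> ints s ''k'' = int k"
  have M: "M > 0" using N by (cases M) auto
  have idx: "(int k * (int N div int M) + int c) mod int N = int ((k * p + c) mod N)" for k c
  proof -
    have "int N div int M = int p" using N M by simp
    then show ?thesis by (simp add: zmod_int)
  qed
  have step: "runs y (take_sample v (int c)) 1 6 Q s"
    if "prep N M s" "ints s ''k'' = int k" "Q (set_arr v (int (1 * M + k)) (?f c k) s)"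
    for v c k Q s
  proof (rule runs_weaken)
    have i: "ival (IMod (IAdd (IMul (IVar ''k'') (IDiv (IVar ''N'') (IVar ''M''))) (IConst (int c))) (IVar ''N'')) s
       = int ((k * p + c) mod N)"
      using that(1,2) idx[of k c] by (simp add: prep_def)
    show "runs y (take_sample v (int c)) 1 (icost (IAdd (IVar ''M'') (IVar ''k'')) +
       icost (IMod (IAdd (IMul (IVar ''k'') (IDiv (IVar ''N'') (IVar ''M''))) (IConst (int c))) (IVar ''N'')) + 1) Q s"
      unfolding take_sample_def
      by (rule runs_Sample; unfold i) (use that N(2) y in \<open>simp_all add: prep_def\<close>)
  qed auto
  have "runs y sampling (M * (1 + 1)) (M * ((6 + 6) + 4) + 3) (?I M) s"
    unfolding sampling_def
  proof (rule runs_for_k[where I = ?I])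
    show "?I 0 (set_int ''k'' 0 s)" using s by (simp add: prep_def)
  next
    fix k s assume "?I k s"
    then show "ints s ''k'' = int k \<and> ints s ''M'' = int M" by (simp add: prep_def)
  next
    fix k s assume k: "k < M" and I: "?I k s"
    let ?Q = "\<lambda>s. ?I (Suc k) (set_int ''k'' (ints s ''k'' + 1) s)"
    let ?s1 = "set_arr ''a'' (int (1 * M + k)) (?f 0 k) s"
    have "?Q (set_arr ''b'' (int (1 * M + k)) (?f 1 k) ?s1)"
      using I by (auto simp: prep_def level_def less_Suc_eq)
    then have "runs y (take_sample ''b'' (int 1)) 1 6 ?Q ?s1"
      using I by (intro step[where k = k]) (simp_all add: prep_def)
    then have "runs y (take_sample ''a'' (int 0)) 1 6 (runs y (take_sample ''b'' (int 1)) 1 6 ?Q) s"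
      using I by (intro step[where k = k and Q = "runs y (take_sample ''b'' (int 1)) 1 6 ?Q"]) blast+
    then show "runs y (Seq (take_sample ''a'' 0) (take_sample ''b'' 1)) (1 + 1) (6 + 6)
        (\<lambda>s. ?I (Suc k) (set_int ''k'' (ints s ''k'' + 1) s)) s"
      by (intro runs_Seq) simp
  qed
  then show ?thesis by (rule runs_weaken) auto
qed

lemma runs_combine:
  assumes s: "ints s ''k'' = int k" "ints s ''M'' = int M" "ints s ''n'' = int n"
    and n: "n > 0" "M = 2 * n * p" "k < M"
    and lv: "level v M n (fft_stage M f n) M s"
    and Q: "Q (set_arr v (int (2 * n * M + k)) (fft_stage M f (2 * n) k) s)"
  shows "runs y (combine v) 0 40 Q s"
proof -
  define e where "e = k div (2 * n) * n + k mod n"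
  have li: "ival lower_index s = int (n * M + e)"
    using s by (simp add: lower_index_def e_def zdiv_int zmod_int)
  have li2: "ival (IAdd lower_index (IDiv (IVar ''M'') (IConst 2))) s = int (n * M + (e + M div 2))"
    using s by (simp add: li zdiv_int)
  \<comment> \<open>The block number is below \<open>p\<close>, hence
    \<open>e < p * n = M div 2\<close>, and the partner \<open>e + M div 2\<close> is still an entry
    of the completed stage.\<close>
  have p: "k div (2 * n) < p"
    using n by (simp add: less_mult_imp_div_less mult.commute)
  have "e < k div (2 * n) * n + n" using n by (simp add: e_def)
  also have "\<dots> = (k div (2 * n) + 1) * n" by simp
  also have "\<dots> \<le> p * n" using p by (intro mult_right_mono) auto
  finally have e: "e + M div 2 < M" using n(2) by (simp add: mult.commute)
  have tw: "cval twiddle s = cis (pi * real k / real n)"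
    using s by (simp add: twiddle_def Arg_minus_1 cis_conv_exp mult_ac)
  have "arrs s v (int (n * M + e)) = fft_stage M f n e"
    "arrs s v (int (n * M + (e + M div 2))) = fft_stage M f n (e + M div 2)"
    using lv e by (simp_all only: level_def)
  then have "cval (CAdd (CGet v lower_index)
       (CMul twiddle (CGet v (IAdd lower_index (IDiv (IVar ''M'') (IConst 2)))))) s
     = fft_stage M f (2 * n) k"
    using fft_stage_double[OF n(1,2), of f k]
    by (simp only: cval.simps tw li li2 e_def)
  then have "Q (set_arr v (ival (IAdd (IMul (IMul (IConst 2) (IVar ''n'')) (IVar ''M'')) (IVar ''k'')) s)
      (cval (CAdd (CGet v lower_index)
       (CMul twiddle (CGet v (IAdd lower_index (IDiv (IVar ''M'') (IConst 2)))))) s) s)"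
    using Q s by simp
  \<comment> \<open>The exact cost is 32, rounded up to 40.\<close>
  then show ?thesis unfolding combine_def
    by (rule runs_weaken[OF runs_CAssign]) (simp_all add: lower_index_def twiddle_def)
qed

definition fft_inv ::
  "nat \<Rightarrow> nat \<Rightarrow> (nat \<Rightarrow> complex) \<Rightarrow> (nat \<Rightarrow> complex) \<Rightarrow> nat \<Rightarrow> nat \<Rightarrow> state \<Rightarrow> bool" where
  "fft_inv N M f g n j s \<longleftrightarrow> prep N M s \<and>
     level ''a'' M n (fft_stage M f n) j s \<and> level ''b'' M n (fft_stage M g n) j s"

lemma runs_fft_stage:
  assumes s: "fft_inv N M f g n M s" "ints s ''n'' = int n" and n: "n > 0" "M = 2 * n * p"
  shows "runs y (for_k (Seq (combine ''a'') (combine ''b''))) 0 (84 * M + 3)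
    (\<lambda>s. fft_inv N M f g (2 * n) M s \<and> ints s ''n'' = int n) s"
proof -
  \<comment> \<open>Stage \<open>n\<close> stays complete while stage \<open>2 * n\<close> is filled
    up to \<open>k\<close>.\<close>
  let ?I = "\<lambda>k s. fft_inv N M f g n M s \<and> fft_inv N M f g (2 * n) k s
    \<and> ints s ''k'' = int k \<and> ints s ''n'' = int n"
  \<comment> \<open>A write to stage \<open>2 * n\<close> lies at least \<open>n * M \<ge> M\<close>
    beyond the start of stage \<open>n\<close>, hence past all its entries.\<close>
  have above: "\<exists>i. int (2 * n * M + k) = int (n * M + i) \<and> M \<le> i" for k
  proof (intro exI conjI)
    show "int (2 * n * M + k) = int (n * M + (n * M + k))" by (simp add: algebra_simps)
    show "M \<le> n * M + k" using n(1) by (cases n) auto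
  qed
  have "runs y (for_k (Seq (combine ''a'') (combine ''b''))) (M * (0 + 0))
      (M * ((40 + 40) + 4) + 3) (?I M) s"
  proof (rule runs_for_k[where I = ?I])
    show "?I 0 (set_int ''k'' 0 s)" using s by (simp add: fft_inv_def prep_def)
  next
    fix k s assume "?I k s"
    then show "ints s ''k'' = int k \<and> ints s ''M'' = int M" by (simp add: fft_inv_def prep_def)
  next
    fix k s assume k: "k < M" and I: "?I k s"
    let ?s1 = "set_arr ''a'' (int (2 * n * M + k)) (fft_stage M f (2 * n) k) s"
    let ?s2 = "set_arr ''b'' (int (2 * n * M + k)) (fft_stage M g (2 * n) k) ?s1"
    have old: "level ''a'' M n (fft_stage M f n) M ?s2" "level ''b'' M n (fft_stage M g n) M ?s2"
      "level ''b'' M n (fft_stage M g n) M ?s1"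
      using I by (auto simp only: fft_inv_def intro!: level_set_arr above)
    have new: "level ''a'' M (2 * n) (fft_stage M f (2 * n)) (Suc k) ?s2"
      "level ''b'' M (2 * n) (fft_stage M g (2 * n)) (Suc k) ?s2"
      using I by (auto simp: fft_inv_def level_def less_Suc_eq)
    have post: "?I (Suc k) (set_int ''k'' (ints ?s2 ''k'' + 1) ?s2)"
      using I old new by (simp add: fft_inv_def prep_def)
    let ?Q = "\<lambda>s. ?I (Suc k) (set_int ''k'' (ints s ''k'' + 1) s)"
    have ctrl: "ints s ''k'' = int k" "ints s ''M'' = int M" "ints s ''n'' = int n"
      "level ''a'' M n (fft_stage M f n) M s"
      using I by (simp_all add: fft_inv_def prep_def)
    have "runs y (combine ''b'') 0 40 ?Q ?s1"
      by (rule runs_combine[where Q = ?Q, OF _ _ _ n k old(3) post]) (simp_all add: ctrl)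
    then have "runs y (combine ''a'') 0 40 (runs y (combine ''b'') 0 40 ?Q) s"
      by (rule runs_combine[OF ctrl(1-3) n k ctrl(4)])
    then show "runs y (Seq (combine ''a'') (combine ''b'')) (0 + 0) (40 + 40)
        (\<lambda>s. ?I (Suc k) (set_int ''k'' (ints s ''k'' + 1) s)) s"
      by (rule runs_Seq)
  qed
  then show ?thesis by (rule runs_weaken) auto
qed

lemma runs_fft:
  assumes s: "fft_inv N M f g 1 M s" and M: "M = 2 ^ L"
  shows "runs y fft 0 (L * (84 * M + 7) + 3) (fft_inv N M f g M M) s"
proof -
  let ?b = "BLess (IVar ''n'') (IVar ''M'')"
  let ?I = "\<lambda>i s. fft_inv N M f g (2 ^ i) M s \<and> ints s ''n'' = int (2 ^ i)"
  have "runs y (While ?b (Seq (for_k (Seq (combine ''a'') (combine ''b'')))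
      (IAssign ''n'' (IMul (IConst 2) (IVar ''n''))))) (L * (0 + 0))
    (L * (bcost ?b + 1 + (84 * M + 3 + (icost (IMul (IConst 2) (IVar ''n'')) + 1))) + (bcost ?b + 1))
    (?I L) (set_int ''n'' 1 s)"
  proof (rule runs_While)
    show "?I 0 (set_int ''n'' 1 s)" using s by (simp add: fft_inv_def prep_def)
  next
    fix i s assume "i \<le> L" and I: "?I i s"
    then have "ints s ''M'' = int (2 ^ L)" "ints s ''n'' = int (2 ^ i)"
      by (simp_all add: fft_inv_def prep_def M)
    then show "bval ?b s \<longleftrightarrow> i < L" by (simp only: bval.simps ival.simps of_nat_less_iff) simp
  next
    fix i s assume i: "i < L" and I: "?I i s"
    \<comment> \<open>The cofactor required by \<open>fft_stage_double\<close> exists because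
      \<open>i < L\<close>.\<close>
    have Mi: "M = 2 * 2 ^ i * 2 ^ (L - Suc i)"
      using i by (simp add: M flip: power_add power_Suc)
    show "runs y (Seq (for_k (Seq (combine ''a'') (combine ''b'')))
      (IAssign ''n'' (IMul (IConst 2) (IVar ''n'')))) (0 + 0)
      (84 * M + 3 + (icost (IMul (IConst 2) (IVar ''n'')) + 1)) (?I (Suc i)) s"
    proof (rule runs_Seq_trans[OF runs_fft_stage[OF _ _ _ Mi]])
      fix s assume "fft_inv N M f g (2 * 2 ^ i) M s \<and> ints s ''n'' = int (2 ^ i)"
      then show "runs y (IAssign ''n'' (IMul (IConst 2) (IVar ''n''))) 0
          (icost (IMul (IConst 2) (IVar ''n'')) + 1) (?I (Suc i)) s"
        by (intro runs_IAssign) (simp add: fft_inv_def prep_def)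
    qed (use I in auto)
  qed
  then have "runs y fft (0 + L * (0 + 0)) (icost (IConst 1) + 1 +
    (L * (bcost ?b + 1 + (84 * M + 3 + (icost (IMul (IConst 2) (IVar ''n'')) + 1))) + (bcost ?b + 1)))
    (?I L) s"
    unfolding fft_def by (intro runs_Seq runs_IAssign) simp
  then show ?thesis by (rule runs_weaken) (auto simp: M algebra_simps)
qed

lemma runs_recover:
  assumes x: "x \<in> carrier_vec N" and N: "N = M * p" "N > 0" and sl: "support_length x \<le> M"
    and s: "fft_inv N M (\<lambda>k. dft x $ ((k * p + 0) mod N)) (\<lambda>k. dft x $ ((k * p + 1) mod N)) M M s"
  shows "runs y recover 0 (50 * M + 3) (\<lambda>s. output_vec N s = x) s"
proof -
  let ?f = "\<lambda>c k. dft x $ ((k * p + c) mod N)"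
  \<comment> \<open>Each round settles one residue class mod \<open>M\<close>; entries of later
    classes still hold the initial 0. At \<open>k = M\<close> every class is settled.\<close>
  let ?I = "\<lambda>k s. ints s ''N'' = int N \<and> ints s ''M'' = int M \<and> ints s ''k'' = int k \<and>
     level ''a'' M M (fft_stage M (?f 0) M) M s \<and> level ''b'' M M (fft_stage M (?f 1) M) M s \<and>
     (\<forall>l<N. arrs s ''x'' (int l) = (if l mod M < k then x $ l else 0))"
  let ?b = "BEq (top_entry ''a'') (COfInt (IConst 0))"
  let ?v = "CDiv (top_entry ''a'') (COfInt (IVar ''M''))"
  have M: "M > 0" using N by (cases M) auto
  have "runs y recover (M * 0) (M * ((bcost ?b + 1 + (icost located_index + ccost ?v + 1)) + 4) + 3)
      (?I M) s"
    unfolding recover_def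
  proof (rule runs_for_k[where I = ?I])
    show "?I 0 (set_int ''k'' 0 s)" using s by (simp add: fft_inv_def prep_def)
  next
    fix k s assume "?I k s"
    then show "ints s ''k'' = int k \<and> ints s ''M'' = int M" by simp
  next
    fix k s assume k: "k < M" and I: "?I k s"
    let ?Q = "\<lambda>s. ?I (Suc k) (set_int ''k'' (ints s ''k'' + 1) s)"
    have top: "cval (top_entry ''a'') s = fft_stage M (?f 0) M k"
      "cval (top_entry ''b'') s = fft_stage M (?f 1) M k"
      using I k by (simp_all add: top_entry_def level_def)
    show "runs y (Cond ?b SKIP (CAssign ''x'' located_index ?v)) 0
        (bcost ?b + 1 + (icost located_index + ccost ?v + 1)) ?Q s"
    proof (rule runs_Cond)
      assume "bval ?b s"
      then have z: "fft_stage M (?f 0) M k = 0" by (simp add: top)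
      \<comment> \<open>A nonzero entry would force a nonzero coefficient in its class, so skipping
        leaves the correct zeros.\<close>
      have "x $ l = 0" if "l < N" "l mod M = k" for l
      proof (rule ccontr)
        assume "x $ l \<noteq> 0"
        from samples_locate[OF x N sl that(1) this, of 0] z that M this show False by simp
      qed
      then have "?Q s" using I by (auto simp: less_Suc_eq)
      then show "runs y SKIP 0 (icost located_index + ccost ?v + 1) ?Q s" by (rule runs_SKIP)
    next
      assume "\<not> bval ?b s"
      then have nz: "fft_stage M (?f 0) M k \<noteq> 0" by (simp add: top)
      then obtain l where l: "l < N" "l mod M = k" "x $ l \<noteq> 0"
        using fft_of_samples_eq_0[OF x N k, of 0] by blast
      have A: "fft_stage M (?f 0) M k = of_nat M * x $ l"
        and B: "fft_stage M (?f 1) M k = of_nat M * (omega N ^ l * x $ l)"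
        using samples_locate[OF x N sl l(1,3), of 0] samples_locate[OF x N sl l(1,3), of 1]
        by (simp_all add: l(2))
      have phase: "fft_stage M (?f 1) M k / fft_stage M (?f 0) M k = omega N ^ l"
        unfolding A B using M l(3) by simp
      have loc: "ival located_index s = int l"
        unfolding located_index_def ival.simps cval.simps top phase
        using index_of_phase[OF l(1)] I by (simp add: Arg_minus_1)
      have val: "cval ?v s = x $ l" using M I by (simp only: cval.simps top A) simp
      \<comment> \<open>The other entries of class \<open>k\<close> vanish, so a single write
        settles the class.\<close>
      have uniq: "x $ i = 0" if "i < N" "i mod M = k" "i \<noteq> l" for i
        using support_residue_unique[OF sl _ _ M _ _ l(1,3), of i] x N that l(2) by auto
      have "?Q (set_arr ''x'' (ival located_index s) (cval ?v s) s)"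
        unfolding loc val using I uniq l by (auto simp: level_def less_Suc_eq)
      then show "runs y (CAssign ''x'' located_index ?v) 0 (icost located_index + ccost ?v + 1) ?Q s"
        by (rule runs_CAssign[where Q = ?Q])
    qed
  qed
  then show ?thesis
  proof (rule runs_weaken)
    fix s assume "?I M s"
    then show "output_vec N s = x"
      using x M by (intro eq_vecI) (auto simp: output_vec_def)
  qed (simp_all add: located_index_def top_entry_def)
qed

section \<open>Composition of the pieces and the final bounds\<close>

lemma runs_reconstruct:
  assumes x: "x \<in> carrier_vec N" and N: "N = 2 ^ L * p" "N > 0"
    and sl: "support_length x \<le> m" and L: "m \<le> 2 ^ L" "\<And>i. i < L \<Longrightarrow> 2 ^ i < m"
  shows "runs (dft x) reconstruct (2 * 2 ^ L) (200 * 2 ^ L * (L + 1))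
    (\<lambda>s. output_vec N s = x) (initial_state N m)"
proof -
  let ?M = "2 ^ L :: nat"
  have d: "dim_vec (dft x) = N" using x by (simp add: dft_def fourier_matrix_def)
  \<comment> \<open>Blocks of length 1 are their own transforms, so the stored samples already form
    stage 1.\<close>
  have st: "fft_stage ?M f 1 = f" for f by (simp add: fft_stage_def fun_eq_iff cis_multiple_2pi)
  have "runs (dft x) reconstruct (0 + (0 + (2 * ?M + (0 + 0))))
    (icost (IConst 1) + 1 + (4 * L + 2 + (16 * ?M + 3 + (L * (84 * ?M + 7) + 3 + (50 * ?M + 3)))))
    (\<lambda>s. output_vec N s = x) (initial_state N m)"
    unfolding reconstruct_def
  proof (rule runs_Seq, rule runs_IAssign, rule runs_Seq_trans, rule runs_grow_loop[OF L])
    fix s assume "prep N ?M s"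
    then show "runs (dft x) (Seq sampling (Seq fft recover)) (2 * ?M + (0 + 0))
      (16 * ?M + 3 + (L * (84 * ?M + 7) + 3 + (50 * ?M + 3))) (\<lambda>s. output_vec N s = x) s"
    proof (rule runs_Seq_trans[OF runs_sampling[OF _ N d]])
      fix s assume *: "prep N ?M s \<and> level ''a'' ?M 1 (\<lambda>k. dft x $ ((k * p + 0) mod N)) ?M s \<and>
        level ''b'' ?M 1 (\<lambda>k. dft x $ ((k * p + 1) mod N)) ?M s"
      show "runs (dft x) (Seq fft recover) (0 + 0)
        (L * (84 * ?M + 7) + 3 + (50 * ?M + 3)) (\<lambda>s. output_vec N s = x) s"
        by (rule runs_Seq_trans[OF runs_fft[OF _ refl] runs_recover[OF x N le_trans[OF sl L(1)]]])
           (use * in \<open>simp_all only: fft_inv_def st\<close>)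
    qed
  qed (simp_all add: initial_state_def)
  then show ?thesis
  proof (rule runs_weaken)
    \<comment> \<open>The left side is \<open>84 * K * L + 11 * L + 66 * K + 12\<close>;
      \<open>K \<ge> 1\<close> absorbs the terms without \<open>K\<close>.\<close>
    have "icost (IConst 1) + 1 + (4 * L + 2 + (16 * K + 3 + (L * (84 * K + 7) + 3 + (50 * K + 3))))
      \<le> 200 * K * (L + 1)" if "K \<ge> 1" for K :: nat
      using that by (cases K) (simp_all add: algebra_simps)
    then show "icost (IConst 1) + 1 + (4 * L + 2 + (16 * ?M + 3 + (L * (84 * ?M + 7) + 3 + (50 * ?M + 3))))
      \<le> 200 * ?M * (L + 1)" by simp
  qed auto
qed

theorem mainTheorem2:
  shows "\<exists>(P :: com) (T :: nat \<Rightarrow> real).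
    T \<in> O(\<lambda>m. real m * log 2 (real m)) \<and>
    (\<forall>(J :: nat) (N :: nat) (m :: nat) (x :: complex vec).
       J > 0 \<and> N = 2 ^ J \<and> x \<in> carrier_vec N \<and>
       support_length x \<le> m \<and> 0 < m \<and> m < N \<longrightarrow>
       (\<exists>q t s. exec (dft x) P (initial_state N m) q t s \<and>
          output_vec N s = x \<and> q < 4 * m \<and> real t \<le> T m))"
proof (rule exI[of _ reconstruct],
    rule exI[of _ "\<lambda>m. 400 * real m * (log 2 (real m) + 2)"], intro conjI allI impI)
  show "(\<lambda>m. 400 * real m * (log 2 (real m) + 2)) \<in> O(\<lambda>m. real m * log 2 (real m))"
  \<comment> \<open>From \<open>m = 2\<close> on the logarithm is at least 1, so
    \<open>log 2 m + 2 \<le> 3 * log 2 m\<close>, and 1200 is \<open>400 * 3\<close>. At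
    \<open>m = 1\<close> the logarithm is 0 and the summand 2 keeps the time bound positive.\<close>
  proof (rule bigoI[of _ 1200], rule eventually_sequentiallyI[of 2])
    fix m :: nat assume m: "2 \<le> m"
    then have "log 2 (real m) \<ge> 1" by (simp add: le_log_iff)
    then have "400 * real m * (log 2 (real m) + 2) \<le> 400 * real m * (3 * log 2 (real m))"
      by (intro mult_left_mono) auto
    with \<open>log 2 (real m) \<ge> 1\<close>
    show "norm (400 * real m * (log 2 (real m) + 2)) \<le> 1200 * norm (real m * log 2 (real m))"
      by (simp add: abs_mult mult_ac)
  qed
next
  fix J N m :: nat and x :: "complex vec"
  assume "J > 0 \<and> N = 2 ^ J \<and> x \<in> carrier_vec N \<and> support_length x \<le> m \<and> 0 < m \<and> m < N"
  then have N: "N = 2 ^ J" and x: "x \<in> carrier_vec N" and sl: "support_length x \<le> m"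
    and m: "0 < m" "m < N" by auto
  define L where "L = (LEAST L. m \<le> 2 ^ L)"
  have L: "m \<le> 2 ^ L" unfolding L_def by (rule LeastI[of _ J]) (use m N in simp)
  have below: "2 ^ i < m" if "i < L" for i
    using not_less_Least[OF that[unfolded L_def]] by simp
  \<comment> \<open>This makes \<open>2 ^ L\<close> a divisor of \<open>N\<close>.\<close>
  have "L \<le> J" unfolding L_def by (rule Least_le) (use m N in simp)
  then have NL: "N = 2 ^ L * 2 ^ (J - L)" "N > 0" by (simp_all add: N flip: power_add)
  \<comment> \<open>By minimality \<open>2 ^ (L - 1) < m\<close> if \<open>L > 0\<close>; for
    \<open>L = 0\<close> this is \<open>0 < m\<close>. Strictness here yields fewer than
    \<open>4 * m\<close> samples.\<close>
  have M: "2 ^ L < 2 * m" using m below[of "L - 1"] by (cases L) auto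
  from runs_reconstruct[OF x NL sl L below] obtain q t s where
    r: "exec (dft x) reconstruct (initial_state N m) q t s" "q \<le> 2 * 2 ^ L"
    "t \<le> 200 * 2 ^ L * (L + 1)" "output_vec N s = x"
    unfolding runs_def by blast
  have "2 ^ L < 2 * real m" using M by (metis of_nat_less_iff of_nat_mult of_nat_numeral of_nat_power)
  then have "log 2 (2 ^ L) < log 2 (2 * real m)" using m by (intro log_less) auto
  then have Llog: "real L < log 2 (real m) + 1" using m by (simp add: log_mult log_nat_power)
  have "real t \<le> real (200 * 2 ^ L * (L + 1))" using r(3) of_nat_mono by blast
  also have "\<dots> = 200 * 2 ^ L * (real L + 1)" by (simp add: algebra_simps)
  \<comment> \<open>Both factors use \<open>2 ^ L < 2 * m\<close>, the second through its logarithm;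
    this is the origin of the factor 400 and of the summand 2.\<close>
  also have "\<dots> \<le> 200 * (2 * real m) * ((log 2 (real m) + 1) + 1)"
    using Llog \<open>2 ^ L < 2 * real m\<close> by (intro mult_mono) auto
  also have "\<dots> = 400 * real m * (log 2 (real m) + 2)" by simp
  finally have "real t \<le> 400 * real m * (log 2 (real m) + 2)" .
  with r M show "\<exists>q t s. exec (dft x) reconstruct (initial_state N m) q t s \<and>
      output_vec N s = x \<and> q < 4 * m \<and> real t \<le> 400 * real m * (log 2 (real m) + 2)"
    by (intro exI[of _ q] exI[of _ t] exI[of _ s]) auto
qed

end
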